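(* Let $(L_d,\mathcal{D}_d,\mathcal{D})$ be an extended discrete nonholonomic Lagrangian system on $\overline{Q}=\mathbb{R}\times Q$ which is invariant under the action of a Lie group $G$ on $\overline{Q}$, and let $\tilde{\xi}:\overline{Q}\to\mathfrak{g}$ be a smooth section of $\mathfrak{g}^{\mathcal{D}}\to\overline{Q}$, i.e. a smooth map with $(\tilde{\xi}(t,q))_{\overline{Q}}(t,q)\in\mathcal{D}_{(t,q)}$ for all $(t,q)\in\overline{Q}$. Then the discrete nonholonomic momentum map $J_d^{nh}$ evolves along the extended discrete Lagrange-d'Alembert (EDLA) map $\Phi$ according to the discrete momentum equation: for every $(t_0,q_0,t_1,q_1)\in\overline{Q}\times\overline{Q}$, with $(t_1,q_1,t_2,q_2)=\Phi(t_0,q_0,t_1,q_1)$, $$\langle J_d^{nh}(t_1,q_1,t_2,q_2),\tilde{\xi}\rangle-\langle J_d^{nh}(t_0,q_0,t_1,q_1),\tilde{\xi}\rangle=\big\langle \Theta_{L_d}^+(t_1,q_1,t_2,q_2),\big(\tilde{\xi}(t_2,q_2)-\tilde{\xi}(t_1,q_1)\big)_{\overline{Q}}(t_2,q_2)\big\rangle .$$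
   Context: $Q$ is a smooth $n$-dimensional manifold, $\overline{Q}=\mathbb{R}\times Q$ with points $(t,q)$. An extended discrete nonholonomic Lagrangian system is a triple $(L_d,\mathcal{D}_d,\mathcal{D})$ where $L_d:\overline{Q}\times\overline{Q}\to\mathbb{R}$ is a smooth function (discrete Lagrangian), $\mathcal{D}_d\subset\overline{Q}\times\overline{Q}$ is a submanifold (discrete constraint space) and $\mathcal{D}$ is a distribution on $\overline{Q}$, such that $\dim\mathcal{D}_d=\dim\mathcal{D}$ (dimension of $\mathcal{D}$ as a submanifold of $T\overline{Q}$) and $(t,q,t,q)\in\mathcal{D}_d$ for all $(t,q)\in\overline{Q}$. Standing assumption: the constraints impose no condition on time velocities, so that the annihilator $\mathcal{D}^o\subset T^*\overline{Q}$ is locally spanned by one-forms with no $dt$ component, i.e. $\partial/\partial t\in\mathcal{D}$. $D_1,D_2,D_3,D_4$ denote the differentials of $L_d(t_0,q_0,t_1,q_1)$ with respect to $t_0,q_0,t_1,q_1$ respectively. The extended discrete Lagrangian one-forms on $\overline{Q}\times\overline{Q}$ are $$\Theta_{L_d}^+(t_0,q_0,t_1,q_1)=D_4L_d\,dq_1+D_3L_d\,dt_1,\qquad \Theta_{L_d}^-(t_0,q_0,t_1,q_1)=-D_2L_d\,dq_0-D_1L_d\,dt_0,$$ with derivatives of $L_d$ evaluated at $(t_0,q_0,t_1,q_1)$. Since $\Theta_{L_d}^+(t_0,q_0,t_1,q_1)$ involves only $dt_1,dq_1$, it can be paired with a tangent vector in $T_{(t_1,q_1)}\overline{Q}$; similarly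 $\Theta_{L_d}^-(t_0,q_0,t_1,q_1)$ can be paired with a vector in $T_{(t_0,q_0)}\overline{Q}$. The extended discrete Euler-Lagrange map is $$D_{\mathrm{DEL}}L_d(t_0,q_0,t_1,q_1,t_2,q_2)=[D_4L_d(t_0,q_0,t_1,q_1)+D_2L_d(t_1,q_1,t_2,q_2)]dq_1+[D_3L_d(t_0,q_0,t_1,q_1)+D_1L_d(t_1,q_1,t_2,q_2)]dt_1\in T^*_{(t_1,q_1)}\overline{Q}.$$ The EDLA equations for $(t_0,q_0),(t_1,q_1),(t_2,q_2)$ are: $D_{\mathrm{DEL}}L_d(t_0,q_0,t_1,q_1,t_2,q_2)\in\mathcal{D}^o_{(t_1,q_1)}$ and $(t_1,q_1,t_2,q_2)\in\mathcal{D}_d$. Standing assumption: the EDLA equations are well posed, i.e. $(t_0,q_0,t_1,q_1)$ determines a unique $(t_2,q_2)$ solving them, giving a map $\Phi:\overline{Q}\times\overline{Q}\to\overline{Q}\times\overline{Q}$, $\Phi(t_0,q_0,t_1,q_1)=(t_1,q_1,t_2,q_2)$. $G$ is a Lie group with Lie algebra $\mathfrak{g}$ acting smoothly on $\overline{Q}$ and diagonally on $\overline{Q}\times\overline{Q}$; $\xi_{\overline{Q}}$ is the infinitesimal generator on $\overline{Q}$ of $\xi\in\mathfrak{g}$, and $\xi_{\overline{Q}\times\overline{Q}}(t_0,q_0,t_1,q_1)=(\xi_{\overline{Q}}(t_0,q_0),\xi_{\overline{Q}}(t_1,q_1))$. The system is $G$-invariant if $L_d$ and $\mathcal{D}_d$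 are invariant under the diagonal action and $\mathcal{D}$ is invariant under the (tangent lifted) action on $\overline{Q}$. For $G$-invariant $L_d$, the discrete momentum map $J_{L_d}:\overline{Q}\times\overline{Q}\to\mathfrak{g}^*$ is $\langle J_{L_d},\xi\rangle=\Theta_{L_d}^+\cdot\xi_{\overline{Q}\times\overline{Q}}=\Theta_{L_d}^-\cdot\xi_{\overline{Q}\times\overline{Q}}$. Set $\mathfrak{g}_{(t,q)}=\{\xi\in\mathfrak{g}\mid\xi_{\overline{Q}}(t,q)\in\mathcal{D}_{(t,q)}\}$ and let $\mathfrak{g}^{\mathcal{D}}\to\overline{Q}$ be the generalized vector bundle (rank may vary) with fiber $\mathfrak{g}_{(t,q)}$ at $(t,q)$. The discrete nonholonomic momentum map $J_d^{nh}$ is the restriction of $J_{L_d}$ to $\mathfrak{g}^{\mathcal{D}}$; its pairing with a section $\tilde{\xi}$ is $\langle J_d^{nh}(t_0,q_0,t_1,q_1),\tilde{\xi}\rangle=\langle J_{L_d}(t_0,q_0,t_1,q_1),\tilde{\xi}(t_1,q_1)\rangle$ (the section is evaluated at the second point). *)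

theory Defs
  imports "HOL-Analysis.Analysis" "HOL-Library.Function_Algebras"
begin

subsection \<open>Functions into a real vector space form a real vector space\<close>

instantiation "fun" :: (type, real_vector) real_vector
begin

definition scaleR_fun_def: "r *\<^sub>R f = (\<lambda>x. r *\<^sub>R f x)"

instance
  by standard
    (simp_all add: scaleR_fun_def plus_fun_def fun_eq_iff algebra_simps)

end


subsection \<open>Smooth manifolds\<close>

text \<open>
  On an open subset of a finite-dimensional space, a function is \<open>C\<^sup>k\<close> iff its iterated
  directional derivatives up to order \<open>k\<close> exist and are continuous. The predicates are only used
  on open sets of that kind.
\<close>

primrec Ck_on ::
  "nat \<Rightarrow> 'a::real_normed_vector set \<Rightarrow> ('a \<Rightarrow> 'b::real_normed_vector) \<Rightarrow> bool"
where
  "Ck_on 0 S f \<longleftrightarrow> continuous_on S f"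
| "Ck_on (Suc k) S f \<longleftrightarrow> (\<forall>x\<in>S. f differentiable at x) \<and>
     (\<forall>v. Ck_on k S (\<lambda>x. frechet_derivative f (at x) v))"

definition smooth_on :: "'a::real_normed_vector set \<Rightarrow> ('a \<Rightarrow> 'b::real_normed_vector) \<Rightarrow> bool"
  where "smooth_on S f \<longleftrightarrow> (\<forall>k. Ck_on k S f)"

text \<open>
  A chart is a pair of a domain and a coordinate map; the values of the coordinate map outside the
  domain are irrelevant. The model space \<open>'e\<close> is any finite-dimensional normed space rather than a
  \<open>euclidean_space\<close>, since the latter class excludes dimension \<open>0\<close>.
\<close>

type_synonym ('m, 'e) chart = "'m set \<times> ('m \<Rightarrow> 'e)"
type_synonym ('m, 'e) atlas = "('m, 'e) chart set"

definition chart_inv :: "('m, 'e) chart \<Rightarrow> 'e \<Rightarrow> 'm"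
  where "chart_inv c = inv_into (fst c) (snd c)"

definition is_chart :: "('m::topological_space, 'e::real_normed_vector) chart \<Rightarrow> bool"
  where "is_chart c \<longleftrightarrow> open (fst c) \<and> open (snd c ` fst c) \<and>
    homeomorphism (fst c) (snd c ` fst c) (snd c) (chart_inv c)"

definition smooth_compatible ::
  "('m, 'e::real_normed_vector) chart \<Rightarrow> ('m, 'e) chart \<Rightarrow> bool"
  where "smooth_compatible c d \<longleftrightarrow>
    smooth_on (snd c ` (fst c \<inter> fst d)) (snd d \<circ> chart_inv c) \<and>
    smooth_on (snd d ` (fst c \<inter> fst d)) (snd c \<circ> chart_inv d)"

definition smooth_manifold ::
  "('m::{t2_space, second_countable_topology}, 'e::real_normed_vector) atlas \<Rightarrow> nat \<Rightarrow> bool"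
  where "smooth_manifold A n \<longleftrightarrow>
    (\<exists>B::'e set. finite B \<and> card B = n \<and> independent B \<and> span B = UNIV) \<and>
    (\<forall>c\<in>A. is_chart c) \<and> (\<Union>c\<in>A. fst c) = UNIV \<and>
    (\<forall>c\<in>A. \<forall>d\<in>A. smooth_compatible c d)"

definition prod_atlas :: "('m, 'e) atlas \<Rightarrow> ('n, 'f) atlas \<Rightarrow> ('m \<times> 'n, 'e \<times> 'f) atlas"
  where "prod_atlas A B = {(fst c \<times> fst d, map_prod (snd c) (snd d)) | c d. c \<in> A \<and> d \<in> B}"

definition id_chart :: "('v, 'v) chart"
  where "id_chart = (UNIV, id)"

definition vec_atlas :: "('v, 'v) atlas"
  where "vec_atlas = {id_chart}"

definition smooth_map ::
  "('m::topological_space, 'e::real_normed_vector) atlas \<Rightarrow>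
   ('n::topological_space, 'f::real_normed_vector) atlas \<Rightarrow> ('m \<Rightarrow> 'n) \<Rightarrow> bool"
  where "smooth_map A B f \<longleftrightarrow> continuous_on UNIV f \<and>
    (\<forall>c\<in>A. \<forall>d\<in>B. smooth_on (snd c ` (fst c \<inter> f -` fst d)) (snd d \<circ> f \<circ> chart_inv c))"


subsection \<open>Tangent vectors\<close>

text \<open>
  A tangent vector at \<open>p\<close> is the family of its coordinate representations in all charts around \<open>p\<close>,
  which transform by the derivatives of the coordinate changes. Entries at other charts are set
  to \<open>0\<close> to make the family unique.
\<close>

type_synonym ('m, 'e) tangent = "('m, 'e) chart \<Rightarrow> 'e"

definition tangent_space :: "('m, 'e::real_normed_vector) atlas \<Rightarrow> 'm \<Rightarrow> ('m, 'e) tangent set"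
  where "tangent_space A p = {v.
    (\<forall>c. \<not> (c \<in> A \<and> p \<in> fst c) \<longrightarrow> v c = 0) \<and>
    (\<forall>c\<in>A. \<forall>d\<in>A. p \<in> fst c \<longrightarrow> p \<in> fst d \<longrightarrow>
       v d = frechet_derivative (snd d \<circ> chart_inv c) (at (snd c p)) (v c))}"

definition chart_at :: "('m, 'e) atlas \<Rightarrow> 'm \<Rightarrow> ('m, 'e) chart"
  where "chart_at A p = (SOME c. c \<in> A \<and> p \<in> fst c)"

text \<open>On genuine tangent vectors the result does not depend on the chart chosen by \<^const>\<open>chart_at\<close>.\<close>

definition tangent_map ::
  "('m, 'e::real_normed_vector) atlas \<Rightarrow> ('n, 'f::real_normed_vector) atlas \<Rightarrow> ('m \<Rightarrow> 'n) \<Rightarrow>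
   'm \<Rightarrow> ('m, 'e) tangent \<Rightarrow> ('n, 'f) tangent"
  where "tangent_map A B f p v =
    (\<lambda>d. if d \<in> B \<and> f p \<in> fst d
         then frechet_derivative (snd d \<circ> f \<circ> chart_inv (chart_at A p)) (at (snd (chart_at A p) p))
                (v (chart_at A p))
         else 0)"

text \<open>The tangent space of a vector space is identified with the space via \<^const>\<open>id_chart\<close>.\<close>

definition differential ::
  "('m, 'e::real_normed_vector) atlas \<Rightarrow> ('m \<Rightarrow> real) \<Rightarrow> 'm \<Rightarrow> ('m, 'e) tangent \<Rightarrow> real"
  where "differential A f p v = tangent_map A vec_atlas f p v id_chart"

definition velocity ::
  "('m, 'e::real_normed_vector) atlas \<Rightarrow> (real \<Rightarrow> 'm) \<Rightarrow> real \<Rightarrow> ('m, 'e) tangent"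
  where "velocity A \<gamma> s = tangent_map vec_atlas A \<gamma> s (\<lambda>c. if c = id_chart then 1 else 0)"

definition cotangent_space ::
  "('m, 'e::real_normed_vector) atlas \<Rightarrow> 'm \<Rightarrow> (('m, 'e) tangent \<Rightarrow> real) set"
  where "cotangent_space A p = {\<alpha>.
    (\<forall>u\<in>tangent_space A p. \<forall>v\<in>tangent_space A p. \<alpha> (u + v) = \<alpha> u + \<alpha> v) \<and>
    (\<forall>r. \<forall>v\<in>tangent_space A p. \<alpha> (r *\<^sub>R v) = r * \<alpha> v)}"


subsection \<open>Distributions and submanifolds\<close>

definition smooth_vector_field_on ::
  "('m::topological_space, 'e::real_normed_vector) atlas \<Rightarrow> 'm set \<Rightarrow>
   ('m \<Rightarrow> ('m, 'e) tangent) \<Rightarrow> bool"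
  where "smooth_vector_field_on A U X \<longleftrightarrow>
    (\<forall>p\<in>U. X p \<in> tangent_space A p) \<and>
    (\<forall>c\<in>A. smooth_on (snd c ` (fst c \<inter> U)) (\<lambda>z. X (chart_inv c z) c))"

text \<open>A distribution of rank \<open>k\<close>, i.e. a smooth vector subbundle of the tangent bundle.\<close>

definition smooth_distribution ::
  "('m::topological_space, 'e::real_normed_vector) atlas \<Rightarrow> ('m \<Rightarrow> ('m, 'e) tangent set) \<Rightarrow>
   nat \<Rightarrow> bool"
  where "smooth_distribution A D k \<longleftrightarrow>
    (\<forall>p. subspace (D p) \<and> D p \<subseteq> tangent_space A p \<and> dim (D p) = k) \<and>
    (\<forall>p. \<exists>U X. open U \<and> p \<in> U \<and> (\<forall>i<k. smooth_vector_field_on A U (X i)) \<and>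
       (\<forall>x\<in>U. D x = span ((\<lambda>i. X i x) ` {..<k})))"

definition annihilator ::
  "('m, 'e::real_normed_vector) atlas \<Rightarrow> ('m \<Rightarrow> ('m, 'e) tangent set) \<Rightarrow> 'm \<Rightarrow>
   (('m, 'e) tangent \<Rightarrow> real) set"
  where "annihilator A D p = {\<alpha> \<in> cotangent_space A p. \<forall>v\<in>D p. \<alpha> v = 0}"

text \<open>Embedded submanifolds, described by slice charts of the smooth structure.\<close>

definition submanifold ::
  "('m::topological_space, 'e::real_normed_vector) atlas \<Rightarrow> 'm set \<Rightarrow> nat \<Rightarrow> bool"
  where "submanifold A S d \<longleftrightarrow>
    (\<forall>p\<in>S. \<exists>c W. is_chart c \<and> (\<forall>c'\<in>A. smooth_compatible c c') \<and> p \<in> fst c \<and>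
       subspace W \<and> dim W = d \<and> snd c ` (fst c \<inter> S) = snd c ` fst c \<inter> W)"


subsection \<open>Lie groups and their actions\<close>

definition lie_group ::
  "('g::{t2_space, second_countable_topology}, 'h::real_normed_vector) atlas \<Rightarrow>
   ('g \<Rightarrow> 'g \<Rightarrow> 'g) \<Rightarrow> 'g \<Rightarrow> ('g \<Rightarrow> 'g) \<Rightarrow> bool"
  where "lie_group AG mul one ginv \<longleftrightarrow>
    (\<exists>m. smooth_manifold AG m) \<and> Groups.group mul one ginv \<and>
    smooth_map (prod_atlas AG AG) AG (\<lambda>(g, h). mul g h) \<and> smooth_map AG AG ginv"

definition lie_group_action ::
  "('g::topological_space, 'h::real_normed_vector) atlas \<Rightarrow> ('g \<Rightarrow> 'g \<Rightarrow> 'g) \<Rightarrow> 'g \<Rightarrow>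
   ('m::topological_space, 'e::real_normed_vector) atlas \<Rightarrow> ('g \<Rightarrow> 'm \<Rightarrow> 'm) \<Rightarrow> bool"
  where "lie_group_action AG mul one A act \<longleftrightarrow>
    (\<forall>x. act one x = x) \<and> (\<forall>g h x. act (mul g h) x = act g (act h x)) \<and>
    smooth_map (prod_atlas AG A) A (\<lambda>(g, x). act g x)"

definition lie_algebra ::
  "('g, 'h::real_normed_vector) atlas \<Rightarrow> 'g \<Rightarrow> ('g, 'h) tangent set"
  where "lie_algebra AG one = tangent_space AG one"

text \<open>
  The generator of \<open>\<xi>\<close> at \<open>x\<close> is the image of \<open>\<xi>\<close> under the tangent map at the identity of the orbit
  map \<open>g \<mapsto> g \<cdot> x\<close>. By the lemma \<open>velocity_action\<close> below, it is the derivative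
  at \<open>s = 0\<close> of \<open>\<gamma>(s) \<cdot> x\<close> for every smooth curve \<open>\<gamma>\<close> in the group that starts at the identity with
  velocity \<open>\<xi>\<close>, in particular for the one-parameter subgroup \<open>\<gamma>(s) = exp(s \<xi>)\<close>.
\<close>

definition inf_generator ::
  "('g, 'h::real_normed_vector) atlas \<Rightarrow> 'g \<Rightarrow> ('m, 'e::real_normed_vector) atlas \<Rightarrow>
   ('g \<Rightarrow> 'm \<Rightarrow> 'm) \<Rightarrow> ('g, 'h) tangent \<Rightarrow> 'm \<Rightarrow> ('m, 'e) tangent"
  where "inf_generator AG one A act \<xi> x = tangent_map AG A (\<lambda>g. act g x) one \<xi>"

text \<open>Tangent vectors of \<open>M \<times> M\<close> at \<open>(x\<^sub>0, x\<^sub>1)\<close> are written as pairs of tangent vectors of \<open>M\<close>.\<close>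

definition diag_generator ::
  "('g, 'h::real_normed_vector) atlas \<Rightarrow> 'g \<Rightarrow> ('m, 'e::real_normed_vector) atlas \<Rightarrow>
   ('g \<Rightarrow> 'm \<Rightarrow> 'm) \<Rightarrow> ('g, 'h) tangent \<Rightarrow> 'm \<times> 'm \<Rightarrow> ('m, 'e) tangent \<times> ('m, 'e) tangent"
  where "diag_generator AG one A act \<xi> p =
    (inf_generator AG one A act \<xi> (fst p), inf_generator AG one A act \<xi> (snd p))"


subsection \<open>Extended discrete nonholonomic Lagrangian systems\<close>

type_synonym 'q ext = "real \<times> 'q"
type_synonym 'e ext_model = "real \<times> 'e"
type_synonym ('q, 'e) ext_tangent = "('q ext, 'e ext_model) tangent"

definition ext_atlas :: "('q, 'e) atlas \<Rightarrow> ('q ext, 'e ext_model) atlas"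
  where "ext_atlas A = prod_atlas vec_atlas A"

definition partial_t :: "('q, 'e::real_normed_vector) atlas \<Rightarrow> 'q ext \<Rightarrow> ('q, 'e) ext_tangent"
  where "partial_t A x = velocity (ext_atlas A) (\<lambda>s. (s, snd x)) (fst x)"

definition dt :: "('q, 'e::real_normed_vector) atlas \<Rightarrow> 'q ext \<Rightarrow> ('q, 'e) ext_tangent \<Rightarrow> real"
  where "dt A x v = differential (ext_atlas A) fst x v"

definition dq ::
  "('q, 'e::real_normed_vector) atlas \<Rightarrow> 'q ext \<Rightarrow> ('q, 'e) ext_tangent \<Rightarrow> ('q, 'e) tangent"
  where "dq A x v = tangent_map (ext_atlas A) A snd x v"

text \<open>
  With \<open>rank D = k\<close>, the total space of the distribution has dimension \<open>(n + 1) + k\<close>.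
\<close>

definition ext_discrete_nh_system ::
  "('q::{t2_space, second_countable_topology}, 'e::real_normed_vector) atlas \<Rightarrow> nat \<Rightarrow>
   ('q ext \<times> 'q ext \<Rightarrow> real) \<Rightarrow> ('q ext \<times> 'q ext) set \<Rightarrow>
   ('q ext \<Rightarrow> ('q, 'e) ext_tangent set) \<Rightarrow> bool"
  where "ext_discrete_nh_system A n L Dd D \<longleftrightarrow>
    smooth_manifold A n \<and>
    smooth_map (prod_atlas (ext_atlas A) (ext_atlas A)) vec_atlas L \<and>
    (\<exists>k. smooth_distribution (ext_atlas A) D k \<and>
         submanifold (prod_atlas (ext_atlas A) (ext_atlas A)) Dd ((n + 1) + k)) \<and>
    (\<forall>x. (x, x) \<in> Dd) \<and>
    (\<forall>x. partial_t A x \<in> D x)"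

text \<open>
  Partial differentials of \<open>L\<close>: those with respect to the times are real numbers, those with respect
  to the positions are covectors on \<open>Q\<close>.
\<close>

fun D1 :: "('q ext \<times> 'q ext \<Rightarrow> real) \<Rightarrow> 'q ext \<times> 'q ext \<Rightarrow> real"
  where "D1 L ((t0, q0), (t1, q1)) = deriv (\<lambda>t. L ((t, q0), (t1, q1))) t0"

fun D2 ::
  "('q, 'e::real_normed_vector) atlas \<Rightarrow> ('q ext \<times> 'q ext \<Rightarrow> real) \<Rightarrow> 'q ext \<times> 'q ext \<Rightarrow>
   ('q, 'e) tangent \<Rightarrow> real"
  where "D2 A L ((t0, q0), (t1, q1)) = differential A (\<lambda>q. L ((t0, q), (t1, q1))) q0"

fun D3 :: "('q ext \<times> 'q ext \<Rightarrow> real) \<Rightarrow> 'q ext \<times> 'q ext \<Rightarrow> real"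
  where "D3 L ((t0, q0), (t1, q1)) = deriv (\<lambda>t. L ((t0, q0), (t, q1))) t1"

fun D4 ::
  "('q, 'e::real_normed_vector) atlas \<Rightarrow> ('q ext \<times> 'q ext \<Rightarrow> real) \<Rightarrow> 'q ext \<times> 'q ext \<Rightarrow>
   ('q, 'e) tangent \<Rightarrow> real"
  where "D4 A L ((t0, q0), (t1, q1)) = differential A (\<lambda>q. L ((t0, q0), (t1, q))) q1"

definition Theta_plus ::
  "('q, 'e::real_normed_vector) atlas \<Rightarrow> ('q ext \<times> 'q ext \<Rightarrow> real) \<Rightarrow> 'q ext \<times> 'q ext \<Rightarrow>
   ('q, 'e) ext_tangent \<times> ('q, 'e) ext_tangent \<Rightarrow> real"
  where "Theta_plus A L p w =
    D4 A L p (dq A (snd p) (snd w)) + D3 L p * dt A (snd p) (snd w)"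

definition Theta_minus ::
  "('q, 'e::real_normed_vector) atlas \<Rightarrow> ('q ext \<times> 'q ext \<Rightarrow> real) \<Rightarrow> 'q ext \<times> 'q ext \<Rightarrow>
   ('q, 'e) ext_tangent \<times> ('q, 'e) ext_tangent \<Rightarrow> real"
  where "Theta_minus A L p w =
    - D2 A L p (dq A (fst p) (fst w)) - D1 L p * dt A (fst p) (fst w)"

text \<open>The pairing with vectors at the second point only.\<close>

definition Theta_plus_snd ::
  "('q, 'e::real_normed_vector) atlas \<Rightarrow> ('q ext \<times> 'q ext \<Rightarrow> real) \<Rightarrow> 'q ext \<times> 'q ext \<Rightarrow>
   ('q, 'e) ext_tangent \<Rightarrow> real"
  where "Theta_plus_snd A L p v = Theta_plus A L p (0, v)"

definition D_DEL ::
  "('q, 'e::real_normed_vector) atlas \<Rightarrow> ('q ext \<times> 'q ext \<Rightarrow> real) \<Rightarrow>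
   'q ext \<Rightarrow> 'q ext \<Rightarrow> 'q ext \<Rightarrow> ('q, 'e) ext_tangent \<Rightarrow> real"
  where "D_DEL A L x0 x1 x2 v =
    (D4 A L (x0, x1) (dq A x1 v) + D2 A L (x1, x2) (dq A x1 v)) +
    (D3 L (x0, x1) + D1 L (x1, x2)) * dt A x1 v"

definition EDLA_equations ::
  "('q, 'e::real_normed_vector) atlas \<Rightarrow> ('q ext \<times> 'q ext \<Rightarrow> real) \<Rightarrow> ('q ext \<times> 'q ext) set \<Rightarrow>
   ('q ext \<Rightarrow> ('q, 'e) ext_tangent set) \<Rightarrow> 'q ext \<Rightarrow> 'q ext \<Rightarrow> 'q ext \<Rightarrow> bool"
  where "EDLA_equations A L Dd D x0 x1 x2 \<longleftrightarrow>
    D_DEL A L x0 x1 x2 \<in> annihilator (ext_atlas A) D x1 \<and> (x1, x2) \<in> Dd"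

definition EDLA_well_posed ::
  "('q, 'e::real_normed_vector) atlas \<Rightarrow> ('q ext \<times> 'q ext \<Rightarrow> real) \<Rightarrow> ('q ext \<times> 'q ext) set \<Rightarrow>
   ('q ext \<Rightarrow> ('q, 'e) ext_tangent set) \<Rightarrow> bool"
  where "EDLA_well_posed A L Dd D \<longleftrightarrow> (\<forall>x0 x1. \<exists>!x2. EDLA_equations A L Dd D x0 x1 x2)"

definition EDLA_map ::
  "('q, 'e::real_normed_vector) atlas \<Rightarrow> ('q ext \<times> 'q ext \<Rightarrow> real) \<Rightarrow> ('q ext \<times> 'q ext) set \<Rightarrow>
   ('q ext \<Rightarrow> ('q, 'e) ext_tangent set) \<Rightarrow> 'q ext \<times> 'q ext \<Rightarrow> 'q ext \<times> 'q ext"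
  where "EDLA_map A L Dd D p =
    (snd p, THE x2. EDLA_equations A L Dd D (fst p) (snd p) x2)"

definition G_invariant_system ::
  "('q, 'e::real_normed_vector) atlas \<Rightarrow> ('g \<Rightarrow> 'q ext \<Rightarrow> 'q ext) \<Rightarrow>
   ('q ext \<times> 'q ext \<Rightarrow> real) \<Rightarrow> ('q ext \<times> 'q ext) set \<Rightarrow>
   ('q ext \<Rightarrow> ('q, 'e) ext_tangent set) \<Rightarrow> bool"
  where "G_invariant_system A act L Dd D \<longleftrightarrow>
    (\<forall>g p. L (map_prod (act g) (act g) p) = L p) \<and>
    (\<forall>g. map_prod (act g) (act g) ` Dd = Dd) \<and>
    (\<forall>g x. tangent_map (ext_atlas A) (ext_atlas A) (act g) x ` D x = D (act g x))"


subsection \<open>Momentum maps\<close>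

definition momentum_map ::
  "('g, 'h::real_normed_vector) atlas \<Rightarrow> 'g \<Rightarrow> ('q, 'e::real_normed_vector) atlas \<Rightarrow>
   ('g \<Rightarrow> 'q ext \<Rightarrow> 'q ext) \<Rightarrow> ('q ext \<times> 'q ext \<Rightarrow> real) \<Rightarrow> 'q ext \<times> 'q ext \<Rightarrow>
   ('g, 'h) tangent \<Rightarrow> real"
  where "momentum_map AG one A act L p \<xi> =
    Theta_plus A L p (diag_generator AG one (ext_atlas A) act \<xi> p)"

definition gD_fiber ::
  "('g, 'h::real_normed_vector) atlas \<Rightarrow> 'g \<Rightarrow> ('q, 'e::real_normed_vector) atlas \<Rightarrow>
   ('g \<Rightarrow> 'q ext \<Rightarrow> 'q ext) \<Rightarrow> ('q ext \<Rightarrow> ('q, 'e) ext_tangent set) \<Rightarrow> 'q ext \<Rightarrow>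
   ('g, 'h) tangent set"
  where "gD_fiber AG one A act D x =
    {\<xi> \<in> lie_algebra AG one. inf_generator AG one (ext_atlas A) act \<xi> x \<in> D x}"

text \<open>
  Each chart \<open>c\<close> around the identity gives a linear isomorphism \<open>\<xi> \<mapsto> \<xi> c\<close> from the Lie algebra to
  the model space; smoothness of a map into the Lie algebra is smoothness in these coordinates.
\<close>

definition smooth_gD_section ::
  "('g, 'h::real_normed_vector) atlas \<Rightarrow> 'g \<Rightarrow>
   ('q::topological_space, 'e::real_normed_vector) atlas \<Rightarrow>
   ('g \<Rightarrow> 'q ext \<Rightarrow> 'q ext) \<Rightarrow> ('q ext \<Rightarrow> ('q, 'e) ext_tangent set) \<Rightarrow>
   ('q ext \<Rightarrow> ('g, 'h) tangent) \<Rightarrow> bool"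
  where "smooth_gD_section AG one A act D \<sigma> \<longleftrightarrow>
    (\<forall>x. \<sigma> x \<in> gD_fiber AG one A act D x) \<and>
    (\<forall>c\<in>AG. one \<in> fst c \<longrightarrow> smooth_map (ext_atlas A) vec_atlas (\<lambda>x. \<sigma> x c))"

definition nh_momentum_map ::
  "('g, 'h::real_normed_vector) atlas \<Rightarrow> 'g \<Rightarrow> ('q, 'e::real_normed_vector) atlas \<Rightarrow>
   ('g \<Rightarrow> 'q ext \<Rightarrow> 'q ext) \<Rightarrow> ('q ext \<times> 'q ext \<Rightarrow> real) \<Rightarrow> 'q ext \<times> 'q ext \<Rightarrow>
   ('q ext \<Rightarrow> ('g, 'h) tangent) \<Rightarrow> real"
  where "nh_momentum_map AG one A act L p \<sigma> = momentum_map AG one A act L p (\<sigma> (snd p))"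


subsection \<open>Products of manifolds; curves and infinitesimal generators\<close>


lemma Ck_on_cong:
  assumes "open S" "\<And>x. x \<in> S \<Longrightarrow> f x = g x" "Ck_on k S f"
  shows "Ck_on k S g"
  using assms(2,3)
proof (induction k arbitrary: f g)
  case 0
  then show ?case by (simp cong: continuous_on_cong)
next
  case (Suc k)
  have ev: "\<forall>\<^sub>F y in nhds x. f y = g y" if "x \<in> S" for x
    using Suc.prems(1) assms(1) that eventually_nhds by blast
  have fr: "frechet_derivative f (at x) = frechet_derivative g (at x)" if "x \<in> S" for x
    unfolding frechet_derivative_def
    using has_derivative_transform_within_open[OF _ assms(1) that] Suc.prems(1)
    by (metis (mono_tags, lifting))
  have "g differentiable at x" if "x \<in> S" for x
    using Suc.prems that assms(1)
    by (metis (no_types, opaque_lifting) Ck_on.simps(2) differentiable_def has_derivative_transform_within_open)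
  moreover have "Ck_on k S (\<lambda>x. frechet_derivative g (at x) v)" for v
    by (rule Suc.IH[of "\<lambda>x. frechet_derivative f (at x) v"]) (use Suc.prems fr in auto)
  ultimately show ?case by simp
qed

lemma has_derivative_map_prod:
  assumes "(f has_derivative f') (at (fst p))" "(g has_derivative g') (at (snd p))"
  shows "(map_prod f g has_derivative map_prod f' g') (at p)"
proof -
  have "((\<lambda>q. (f (fst q), g (snd q))) has_derivative (\<lambda>h. (f' (fst h), g' (snd h)))) (at p)"
    by (intro has_derivative_Pair has_derivative_compose[OF has_derivative_fst[OF has_derivative_ident] assms(1)]
      has_derivative_compose[OF has_derivative_snd[OF has_derivative_ident] assms(2)])
  then show ?thesis by (simp add: map_prod_def case_prod_beta')
qed

lemma Ck_on_map_prod: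
  assumes "open S" "open T" "Ck_on k S f" "Ck_on k T g"
  shows "Ck_on k (S \<times> T) (map_prod f g)"
  using assms(3,4)
proof (induction k arbitrary: f g)
  case 0
  then show ?case
    unfolding map_prod_def case_prod_beta
    by (auto intro!: continuous_on_Pair continuous_on_compose2[OF _ continuous_on_fst[OF continuous_on_id]]
      continuous_on_compose2[OF _ continuous_on_snd[OF continuous_on_id]])
next
  case (Suc k)
  have D: "(map_prod f g has_derivative
      map_prod (frechet_derivative f (at (fst p))) (frechet_derivative g (at (snd p)))) (at p)"
    if "p \<in> S \<times> T" for p
    using that Suc.prems
    by (intro has_derivative_map_prod) (auto simp: frechet_derivative_works[symmetric])
  have "Ck_on k (S \<times> T) (\<lambda>p. frechet_derivative (map_prod f g) (at p) v)" for v
  proof (rule Ck_on_cong)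
    show "open (S \<times> T)" using assms by (simp add: open_Times)
    show "Ck_on k (S \<times> T) (map_prod (\<lambda>x. frechet_derivative f (at x) (fst v))
        (\<lambda>x. frechet_derivative g (at x) (snd v)))"
      by (rule Suc.IH) (use Suc.prems in auto)
    show "map_prod (\<lambda>x. frechet_derivative f (at x) (fst v))
        (\<lambda>x. frechet_derivative g (at x) (snd v)) p = frechet_derivative (map_prod f g) (at p) v"
      if "p \<in> S \<times> T" for p
      unfolding frechet_derivative_at[OF D[OF that], symmetric] by (simp add: prod_eq_iff)
  qed
  moreover have "map_prod f g differentiable at p" if "p \<in> S \<times> T" for p
    using D[OF that] by (rule differentiableI)
  ultimately show ?case by simp
qed

lemma smooth_on_map_prod:
  assumes "open S" "open T" "smooth_on S f" "smooth_on T g"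
  shows "smooth_on (S \<times> T) (map_prod f g)"
  using assms Ck_on_map_prod unfolding smooth_on_def by blast

lemma chart_inv_prod:
  assumes "p \<in> (snd c ` fst c) \<times> (snd d ` fst d)" "is_chart c" "is_chart d"
  shows "chart_inv (fst c \<times> fst d, map_prod (snd c) (snd d)) p = map_prod (chart_inv c) (chart_inv d) p"
proof -
  have "inj_on (snd c) (fst c)" "inj_on (snd d) (fst d)"
    using assms(2,3) unfolding is_chart_def homeomorphism_def by (metis inj_onI)+
  then have i: "inj_on (map_prod (snd c) (snd d)) (fst c \<times> fst d)"
    by (auto simp: inj_on_def)
  show ?thesis unfolding chart_inv_def
    using assms(1) by (auto intro!: inv_into_f_eq[OF i[unfolded]] simp: inv_into_into f_inv_into_f)
qed

lemma is_chart_prod: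
  assumes "is_chart c" "is_chart d"
  shows "is_chart (fst c \<times> fst d, map_prod (snd c) (snd d))"
proof -
  have im: "map_prod (snd c) (snd d) ` (fst c \<times> fst d) = (snd c ` fst c) \<times> (snd d ` fst d)"
    by (rule map_prod_surj_on) auto
  have inv: "chart_inv c ` snd c ` fst c = fst c" "chart_inv d ` snd d ` fst d = fst d"
    using assms unfolding is_chart_def homeomorphism_def by auto
  have "homeomorphism (fst c \<times> fst d) ((snd c ` fst c) \<times> (snd d ` fst d))
      (map_prod (snd c) (snd d)) (map_prod (chart_inv c) (chart_inv d))"
    unfolding homeomorphism_def
  proof (intro conjI)
    show "continuous_on (fst c \<times> fst d) (map_prod (snd c) (snd d))"
      using assms unfolding is_chart_def homeomorphism_def map_prod_def case_prod_beta
      by (auto intro!: continuous_on_Pair continuous_on_compose2[OF _ continuous_on_fst[OF continuous_on_id]]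
        continuous_on_compose2[OF _ continuous_on_snd[OF continuous_on_id]])
    show "continuous_on ((snd c ` fst c) \<times> (snd d ` fst d)) (map_prod (chart_inv c) (chart_inv d))"
      using assms unfolding is_chart_def homeomorphism_def map_prod_def case_prod_beta
      by (auto intro!: continuous_on_Pair continuous_on_compose2[OF _ continuous_on_fst[OF continuous_on_id]]
        continuous_on_compose2[OF _ continuous_on_snd[OF continuous_on_id]])
    show "map_prod (chart_inv c) (chart_inv d) ` ((snd c ` fst c) \<times> (snd d ` fst d)) = fst c \<times> fst d"
      using inv by (intro map_prod_surj_on) auto
  qed (use assms im in \<open>auto simp: is_chart_def homeomorphism_def\<close>)
  then have "homeomorphism (fst c \<times> fst d) ((snd c ` fst c) \<times> (snd d ` fst d))
      (map_prod (snd c) (snd d)) (chart_inv (fst c \<times> fst d, map_prod (snd c) (snd d)))"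
    by (rule homeomorphism_cong) (use chart_inv_prod[OF _ assms] in auto)
  then show ?thesis
    using assms unfolding is_chart_def by (simp add: im open_Times)
qed

lemma open_chart_image:
  assumes "is_chart c" "open U"
  shows "open (snd c ` (fst c \<inter> U))"
proof -
  have h: "homeomorphism (fst c) (snd c ` fst c) (snd c) (chart_inv c)" and o: "open (snd c ` fst c)"
    using assms(1) unfolding is_chart_def by auto
  have "openin (top_of_set (snd c ` fst c)) (snd c ` (fst c \<inter> U))"
    using homeomorphism_imp_open_map[OF h, of "fst c \<inter> U"] assms(2) by (simp add: openin_open_Int)
  then show ?thesis using o openin_open_trans by blast
qed

lemma smooth_on_cong:
  assumes "open S" "\<And>x. x \<in> S \<Longrightarrow> f x = g x" "smooth_on S f"
  shows "smooth_on S g"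
  using assms Ck_on_cong unfolding smooth_on_def by blast

lemma smooth_transition_prod:
  assumes "is_chart c" "is_chart d" "is_chart c'" "is_chart d'"
    and "smooth_compatible c c'" "smooth_compatible d d'"
  shows "smooth_on (map_prod (snd c) (snd d) ` (fst c \<times> fst d \<inter> fst c' \<times> fst d'))
    (map_prod (snd c') (snd d') \<circ> chart_inv (fst c \<times> fst d, map_prod (snd c) (snd d)))"
proof -
  have im: "map_prod (snd c) (snd d) ` (fst c \<times> fst d \<inter> fst c' \<times> fst d')
      = (snd c ` (fst c \<inter> fst c')) \<times> (snd d ` (fst d \<inter> fst d'))"
    unfolding Times_Int_Times by (rule map_prod_surj_on) auto
  have op: "open (snd c ` (fst c \<inter> fst c'))" "open (snd d ` (fst d \<inter> fst d'))"
    using assms(1-4) by (auto intro!: open_chart_image simp: is_chart_def)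
  show ?thesis unfolding im
    by (rule smooth_on_cong[OF _ _ smooth_on_map_prod[OF op,
        of "snd c' \<circ> chart_inv c" "snd d' \<circ> chart_inv d"]])
      (use op assms in \<open>auto simp: open_Times chart_inv_prod smooth_compatible_def\<close>)
qed

lemma basis_prod:
  fixes B1 :: "'e::real_vector set" and B2 :: "'f::real_vector set"
  assumes "finite B1" "independent B1" "span B1 = UNIV" "finite B2" "independent B2" "span B2 = UNIV"
  shows "\<exists>B::('e \<times> 'f) set. finite B \<and> card B = card B1 + card B2 \<and> independent B \<and> span B = UNIV"
proof -
  let ?f = "\<lambda>b. (b, 0::'f)" and ?g = "\<lambda>b. (0::'e, b)"
  let ?B = "?f ` B1 \<union> ?g ` B2"
  have z: "0 \<notin> B1" "0 \<notin> B2" using assms dependent_zero by auto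
  have disj: "?f ` B1 \<inter> ?g ` B2 = {}" using z by auto
  have i: "inj_on ?f B1" "inj_on ?g B2" by (auto simp: inj_on_def)
  have fin: "finite ?B" using assms by auto
  have card: "card ?B = card B1 + card B2"
    using assms disj i by (simp add: card_Un_disjoint card_image)
  have "independent ?B"
  proof
    assume "dependent ?B"
    then obtain u where u: "\<exists>v\<in>?B. u v \<noteq> 0" "(\<Sum>v\<in>?B. u v *\<^sub>R v) = 0"
      using dependent_finite[OF fin] by auto
    have "(\<Sum>v\<in>?B. u v *\<^sub>R v) = (\<Sum>v\<in>B1. u (?f v) *\<^sub>R ?f v) + (\<Sum>v\<in>B2. u (?g v) *\<^sub>R ?g v)"
      using assms disj i by (simp add: sum.union_disjoint sum.reindex del: scaleR_Pair)
    then have "(\<Sum>v\<in>B1. u (?f v) *\<^sub>R v) = 0" "(\<Sum>v\<in>B2. u (?g v) *\<^sub>R v) = 0"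
      using u(2) by (auto simp: prod_eq_iff fst_sum snd_sum)
    then have "\<forall>v\<in>B1. u (?f v) = 0" "\<forall>v\<in>B2. u (?g v) = 0"
      using assms independentD[of B1 B1 "\<lambda>v. u (?f v)"] independentD[of B2 B2 "\<lambda>v. u (?g v)"] by auto
    then show False using u(1) by auto
  qed
  moreover have "span ?B = UNIV"
  proof -
    have lf: "linear ?f" "linear ?g" by (auto intro!: linearI)
    have "(a, b) \<in> span ?B" for a b
    proof -
      have "?f a \<in> span (?f ` B1)" using linear_span_image[OF lf(1), of B1] assms by auto
      moreover have "?g b \<in> span (?g ` B2)" using linear_span_image[OF lf(2), of B2] assms by auto
      ultimately have "?f a + ?g b \<in> span ?B"
        using span_mono[of "?f ` B1" ?B] span_mono[of "?g ` B2" ?B] by (intro span_add) blast+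
      then show ?thesis by simp
    qed
    then show ?thesis by auto
  qed
  ultimately show ?thesis using fin card by blast
qed

lemma smooth_manifold_prod:
  assumes "smooth_manifold A n" "smooth_manifold B m"
  shows "smooth_manifold (prod_atlas A B) (n + m)"
  unfolding smooth_manifold_def
proof (intro conjI ballI)
  show "\<exists>B::('b \<times> 'd) set. finite B \<and> card B = n + m \<and> independent B \<and> span B = UNIV"
    using assms basis_prod unfolding smooth_manifold_def by blast
  show "is_chart c" if "c \<in> prod_atlas A B" for c
    using that assms is_chart_prod unfolding smooth_manifold_def prod_atlas_def by blast
  show "\<Union> (fst ` prod_atlas A B) = UNIV"
  proof -
    have "(x, y) \<in> \<Union> (fst ` prod_atlas A B)" for x y
    proof -
      obtain c d where "c \<in> A" "x \<in> fst c" "d \<in> B" "y \<in> fst d"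
        using assms unfolding smooth_manifold_def by blast
      then have "(fst c \<times> fst d, map_prod (snd c) (snd d)) \<in> prod_atlas A B"
        "(x, y) \<in> fst (fst c \<times> fst d, map_prod (snd c) (snd d))"
        unfolding prod_atlas_def by (blast, simp)
      then show ?thesis by blast
    qed
    then show ?thesis by auto
  qed
  show "smooth_compatible c d" if cd: "c \<in> prod_atlas A B" "d \<in> prod_atlas A B" for c d
  proof -
    obtain c1 c2 where c: "c = (fst c1 \<times> fst c2, map_prod (snd c1) (snd c2))" "c1 \<in> A" "c2 \<in> B"
      using cd(1) unfolding prod_atlas_def by blast
    obtain d1 d2 where d: "d = (fst d1 \<times> fst d2, map_prod (snd d1) (snd d2))" "d1 \<in> A" "d2 \<in> B"
      using cd(2) unfolding prod_atlas_def by blast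
    note * = c d
    have "is_chart c1" "is_chart c2" "is_chart d1" "is_chart d2"
      "smooth_compatible c1 d1" "smooth_compatible c2 d2" "smooth_compatible d1 c1" "smooth_compatible d2 c2"
      using assms * unfolding smooth_manifold_def by auto
    then show ?thesis
      using smooth_transition_prod[of c1 c2 d1 d2] smooth_transition_prod[of d1 d2 c1 c2]
      unfolding smooth_compatible_def * by (simp add: Int_commute)
  qed
qed

lemma Ck_on_const: "Ck_on k S (\<lambda>_. a)"
  by (induction k arbitrary: a) (simp_all add: frechet_derivative_const)

lemma smooth_on_id: "smooth_on S (\<lambda>x. x)"
proof -
  have "Ck_on k S (\<lambda>x. x)" for k
    by (cases k) (simp_all add: frechet_derivative_ident[unfolded id_def] Ck_on_const)
  then show ?thesis by (simp add: smooth_on_def)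
qed

lemma chart_inv_id_chart: "chart_inv id_chart = id"
  by (simp add: chart_inv_def id_chart_def)

lemma smooth_manifold_real: "smooth_manifold (vec_atlas :: (real, real) atlas) 1"
  unfolding smooth_manifold_def
proof (intro conjI)
  show "\<exists>B::real set. finite B \<and> card B = 1 \<and> independent B \<and> span B = UNIV"
    by (rule exI[of _ Basis]) (auto simp: independent_Basis simp del: Basis_real_def)
next
  have "smooth_on UNIV (id :: real \<Rightarrow> real)"
    using smooth_on_id by (simp add: id_def)
  then show "\<forall>c\<in>(vec_atlas :: (real, real) atlas). \<forall>d\<in>vec_atlas. smooth_compatible c d"
    by (simp add: vec_atlas_def smooth_compatible_def chart_inv_id_chart) (simp add: id_chart_def)
  have "homeomorphism UNIV UNIV (id :: real \<Rightarrow> real) id"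
    by (simp add: homeomorphism_def)
  then show "\<forall>c\<in>(vec_atlas :: (real, real) atlas). is_chart c"
    by (simp add: vec_atlas_def is_chart_def chart_inv_id_chart) (simp add: id_chart_def)
qed (simp add: vec_atlas_def id_chart_def)

lemma smooth_manifold_ext:
  assumes "smooth_manifold A n"
  shows "smooth_manifold (ext_atlas A) (n + 1)"
  using smooth_manifold_prod[OF smooth_manifold_real assms] by (simp add: ext_atlas_def)

lemma chart_at:
  assumes "smooth_manifold A n"
  shows "chart_at A p \<in> A" "p \<in> fst (chart_at A p)"
proof -
  have "\<exists>c. c \<in> A \<and> p \<in> fst c" using assms unfolding smooth_manifold_def by blast
  from someI_ex[OF this] show "chart_at A p \<in> A" "p \<in> fst (chart_at A p)"
    unfolding chart_at_def by auto
qed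

lemma chart_inv_coord:
  assumes "is_chart c" "p \<in> fst c"
  shows "chart_inv c (snd c p) = p"
  using assms unfolding is_chart_def homeomorphism_def by auto

lemma smooth_map_differentiable:
  assumes "is_chart c" "is_chart d" "smooth_map A B f" "c \<in> A" "d \<in> B" "p \<in> fst c" "f p \<in> fst d"
  shows "(snd d \<circ> f \<circ> chart_inv c) differentiable at (snd c p)"
proof -
  have "smooth_on (snd c ` (fst c \<inter> f -` fst d)) (snd d \<circ> f \<circ> chart_inv c)"
    using assms unfolding smooth_map_def by blast
  then have "Ck_on (Suc 0) (snd c ` (fst c \<inter> f -` fst d)) (snd d \<circ> f \<circ> chart_inv c)"
    unfolding smooth_on_def by blast
  then show ?thesis using assms by auto
qed

lemma velocity_action:
  assumes A: "smooth_manifold A n" and G: "lie_group AG mul one ginv"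
    and act: "lie_group_action AG mul one A act"
    and \<gamma>: "smooth_map vec_atlas AG \<gamma>" "\<gamma> 0 = one" "velocity AG \<gamma> 0 = \<xi>"
  shows "velocity A (\<lambda>s. act (\<gamma> s) x) 0 = inf_generator AG one A act \<xi> x"
proof
  fix d
  obtain m where AG: "smooth_manifold AG m" using G unfolding lie_group_def by blast
  have id_at: "chart_at vec_atlas p = id_chart" for p :: real
    unfolding chart_at_def by (rule some_equality) (auto simp: vec_atlas_def id_chart_def)
  define a where "a = chart_at AG one"
  define c where "c = chart_at A x"
  have a: "a \<in> AG" "one \<in> fst a" "is_chart a" and c: "c \<in> A" "x \<in> fst c" "is_chart c"
    using chart_at[OF AG] chart_at[OF A] AG A unfolding a_def c_def smooth_manifold_def by blast+
  have act1: "act one x = x" using act unfolding lie_group_action_def by blast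
  show "velocity A (\<lambda>s. act (\<gamma> s) x) 0 d = inf_generator AG one A act \<xi> x d"
  proof (cases "d \<in> A \<and> x \<in> fst d")
    case False
    then show ?thesis
      using act1 \<gamma>(2) by (auto simp: velocity_def inf_generator_def tangent_map_def)
  next
    case True
    then have d: "is_chart d" using A unfolding smooth_manifold_def by blast
    let ?F = "snd d \<circ> (\<lambda>g. act g x) \<circ> chart_inv a"
    let ?H = "snd a \<circ> \<gamma> \<circ> chart_inv id_chart"
    let ?p = "(fst a \<times> fst c, map_prod (snd a) (snd c))"
    have H: "?H differentiable at 0"
      using smooth_map_differentiable[of id_chart a vec_atlas AG \<gamma> 0] a \<gamma> smooth_manifold_real
      by (simp add: smooth_manifold_def vec_atlas_def) (simp add: id_chart_def)
    have "?p \<in> prod_atlas AG A" using a c unfolding prod_atlas_def by blast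
    then have "(snd d \<circ> (\<lambda>(g, x). act g x) \<circ> chart_inv ?p) differentiable at (snd ?p (one, x))"
      using a c d True act act1 unfolding lie_group_action_def
      by (intro smooth_map_differentiable[of _ _ "prod_atlas AG A" A] is_chart_prod) auto
    then have P: "(snd d \<circ> (\<lambda>(g, x). act g x) \<circ> chart_inv ?p) differentiable at (snd a one, snd c x)"
      by simp
    have j: "(\<lambda>z. (z, snd c x)) differentiable at (snd a one)"
      by (auto intro!: derivative_eq_intros simp: differentiable_def)
    have "((snd d \<circ> (\<lambda>(g, x). act g x) \<circ> chart_inv ?p) \<circ> (\<lambda>z. (z, snd c x))) differentiable at (snd a one)"
      by (rule differentiable_chain_at[OF j P])
    then obtain F' where F': "((snd d \<circ> (\<lambda>(g, x). act g x) \<circ> chart_inv ?p) \<circ> (\<lambda>z. (z, snd c x)) has_derivative F')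
        (at (snd a one))"
      unfolding differentiable_def by blast
    have "(?F has_derivative F') (at (snd a one))"
    proof (rule has_derivative_transform_within_open[OF F'])
      show "open (snd a ` fst a)" using a(3) unfolding is_chart_def by blast
      show "snd a one \<in> snd a ` fst a" using a by blast
      show "((snd d \<circ> (\<lambda>(g, x). act g x) \<circ> chart_inv ?p) \<circ> (\<lambda>z. (z, snd c x))) z = ?F z"
        if "z \<in> snd a ` fst a" for z
        using that chart_inv_prod[of "(z, snd c x)" a c] a c chart_inv_coord[of c x] by simp
    qed
    then have F: "?F differentiable at (?H 0)"
      using \<gamma>(2) unfolding differentiable_def by (auto simp: chart_inv_id_chart)
    define U where "U = \<gamma> -` fst a"
    have "open U"
      using \<gamma>(1) a(3) open_vimage unfolding smooth_map_def is_chart_def U_def by blast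
    moreover have "0 \<in> U" using a \<gamma>(2) by (simp add: U_def)
    ultimately have U: "open U" "0 \<in> U" "\<And>s. s \<in> U \<Longrightarrow> \<gamma> s \<in> fst a"
      by (auto simp: U_def)
    let ?K = "snd d \<circ> (\<lambda>s. act (\<gamma> s) x) \<circ> chart_inv id_chart"
    have "(?F \<circ> ?H has_derivative frechet_derivative ?F (at (?H 0)) \<circ> frechet_derivative ?H (at 0)) (at 0)"
      using F H by (intro diff_chain_at) (simp_all add: frechet_derivative_works)
    then have "(?K has_derivative frechet_derivative ?F (at (?H 0)) \<circ> frechet_derivative ?H (at 0)) (at 0)"
      by (rule has_derivative_transform_within_open[OF _ U(1,2)])
        (use chart_inv_coord[OF a(3) U(3)] in \<open>simp add: chart_inv_id_chart\<close>)
    then have K: "frechet_derivative ?K (at 0) =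
        frechet_derivative ?F (at (?H 0)) \<circ> frechet_derivative ?H (at 0)"
      by (rule frechet_derivative_at[symmetric])
    have xi: "\<xi> a = frechet_derivative ?H (at 0) 1"
      using a \<gamma>(2) unfolding \<gamma>(3)[symmetric] velocity_def tangent_map_def id_at
      by (simp add: id_chart_def)
    have "velocity A (\<lambda>s. act (\<gamma> s) x) 0 d = frechet_derivative ?K (at 0) 1"
      using True act1 \<gamma>(2) unfolding velocity_def tangent_map_def id_at by (simp add: id_chart_def)
    also have "\<dots> = frechet_derivative ?F (at (snd a one)) (\<xi> a)"
      using K xi \<gamma>(2) by (simp add: chart_inv_id_chart)
    also have "\<dots> = inf_generator AG one A act \<xi> x d"
      using True act1 unfolding inf_generator_def tangent_map_def a_def by simp
    finally show ?thesis .
  qed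
qed

end

theory Submission
  imports Defs
begin

text \<open>
  Differentiating \<open>L(g \<cdot> x\<^sub>1, g \<cdot> x\<^sub>2) = L(x\<^sub>1, x\<^sub>2)\<close> at the identity in the direction \<open>\<xi>\<close> and
  splitting the derivative into its two partial contributions gives
  \<open>\<Theta>\<^sup>+(x\<^sub>1, x\<^sub>2) \<cdot> \<xi> = \<Theta>\<^sup>-(x\<^sub>1, x\<^sub>2) \<cdot> \<xi>\<close>. For \<open>\<xi> = \<sigma>(x\<^sub>1)\<close> the generator at \<open>x\<^sub>1\<close> lies in the
  distribution, so the EDLA equations give \<open>\<Theta>\<^sup>+(x\<^sub>0, x\<^sub>1) \<cdot> \<xi> = \<Theta>\<^sup>-(x\<^sub>1, x\<^sub>2) \<cdot> \<xi>\<close>. Hence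
  \<open>\<langle>J(x\<^sub>0, x\<^sub>1), \<sigma>(x\<^sub>1)\<rangle> = \<langle>J(x\<^sub>1, x\<^sub>2), \<sigma>(x\<^sub>1)\<rangle>\<close>, and the claim is linearity of \<open>\<Theta>\<^sup>+(x\<^sub>1, x\<^sub>2)\<close>.
\<close>

subsection \<open>Differentiability at a point of a manifold\<close>

text \<open>First-order differentiability at one point is all that the momentum equation uses, and
  it composes easily. Continuity is a separate clause because coordinate maps are arbitrary off
  their domains: a differentiable coordinate expression alone would not keep \<open>f\<close> inside
  the target chart. Quantifying over all charts leaves the intermediate chart of the chain rule
  free.\<close>

definition mdiff_at ::
  "('m::t2_space, 'e::real_normed_vector) atlas \<Rightarrow>
   ('n::t2_space, 'f::real_normed_vector) atlas \<Rightarrow> ('m \<Rightarrow> 'n) \<Rightarrow> 'm \<Rightarrow> bool"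
  where "mdiff_at A B f p \<longleftrightarrow> isCont f p \<and>
    (\<forall>c\<in>A. \<forall>d\<in>B. p \<in> fst c \<longrightarrow> f p \<in> fst d \<longrightarrow>
       (snd d \<circ> f \<circ> chart_inv c) differentiable at (snd c p))"

lemma smooth_manifold_chart: "smooth_manifold A n \<Longrightarrow> c \<in> A \<Longrightarrow> is_chart c"
  unfolding smooth_manifold_def by blast

lemma smooth_map_mdiff_at:
  assumes "smooth_manifold A n" "smooth_manifold B m" "smooth_map A B f"
  shows "mdiff_at A B f p"
  unfolding mdiff_at_def
proof (intro conjI ballI impI)
  show "isCont f p"
    using assms(3) by (simp add: smooth_map_def continuous_on_eq_continuous_at)
  show "(snd d \<circ> f \<circ> chart_inv c) differentiable at (snd c p)"
    if "c \<in> A" "d \<in> B" "p \<in> fst c" "f p \<in> fst d" for c d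
    using smooth_map_differentiable[OF smooth_manifold_chart[OF assms(1)]
        smooth_manifold_chart[OF assms(2)] assms(3)] that by simp
qed

lemma isCont_chart_inv:
  assumes "is_chart c" "p \<in> fst c"
  shows "isCont (chart_inv c) (snd c p)"
  using assms unfolding is_chart_def homeomorphism_def
  by (auto simp: continuous_on_eq_continuous_at)

text \<open>With \<open>U\<close> a chart domain, this gives a neighbourhood on which a coordinate
  map and its inverse may be cancelled after applying \<open>f\<close>.\<close>

lemma eventually_chart_inv:
  assumes "is_chart c" "p \<in> fst c" "isCont f p" "open U" "f p \<in> U"
  shows "\<forall>\<^sub>F z in nhds (snd c p). f (chart_inv c z) \<in> U"
proof -
  have "isCont (\<lambda>z. f (chart_inv c z)) (snd c p)"
    using assms(1-3) chart_inv_coord[OF assms(1,2)]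
    by (intro continuous_at_compose[OF isCont_chart_inv, unfolded o_def]) auto
  from topological_tendstoD[OF this[unfolded isCont_def tendsto_at_iff_tendsto_nhds] assms(4)]
  show ?thesis
    using assms(5) chart_inv_coord[OF assms(1,2)] by (simp add: eventually_nhds_conv_at)
qed

lemma has_derivative_cong_nhds:
  assumes "(f has_derivative F) (at x)" "\<forall>\<^sub>F z in nhds x. f z = g z"
  shows "(g has_derivative F) (at x)"
  using assms(1)
  by (rule has_derivative_transform_eventually)
    (use assms(2) eventually_nhds_x_imp_x in \<open>auto simp: eventually_at_filter elim: eventually_mono\<close>)

section \<open>The chain rule for tangent maps\<close>

lemma mdiff_at_has_derivative:
  assumes "mdiff_at A B f p" "c \<in> A" "d \<in> B" "p \<in> fst c" "f p \<in> fst d"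
  shows "(snd d \<circ> f \<circ> chart_inv c has_derivative
    frechet_derivative (snd d \<circ> f \<circ> chart_inv c) (at (snd c p))) (at (snd c p))"
  using assms unfolding mdiff_at_def by (auto simp: frechet_derivative_works)

text \<open>The two coordinate expressions compose to that of \<open>g \<circ> f\<close> only where
  \<open>f\<close> stays in the domain of \<open>b\<close>. By continuity this covers a
  neighbourhood, and derivatives are local.\<close>

lemma has_derivative_chart_comp:
  assumes "is_chart a" "is_chart b" "mdiff_at A B f p" "mdiff_at B C g (f p)"
    "a \<in> A" "b \<in> B" "c \<in> C" "p \<in> fst a" "f p \<in> fst b" "g (f p) \<in> fst c"
  shows "(snd c \<circ> (g \<circ> f) \<circ> chart_inv a has_derivative
    frechet_derivative (snd c \<circ> g \<circ> chart_inv b) (at (snd b (f p))) \<circ>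
    frechet_derivative (snd b \<circ> f \<circ> chart_inv a) (at (snd a p))) (at (snd a p))"
proof -
  let ?F = "snd b \<circ> f \<circ> chart_inv a" and ?G = "snd c \<circ> g \<circ> chart_inv b"
  have p: "?F (snd a p) = snd b (f p)"
    using assms by (simp add: chart_inv_coord)
  have "(?G \<circ> ?F has_derivative frechet_derivative ?G (at (snd b (f p))) \<circ>
      frechet_derivative ?F (at (snd a p))) (at (snd a p))"
    by (rule diff_chain_at[OF mdiff_at_has_derivative[OF assms(3,5,6,8,9)]])
      (use mdiff_at_has_derivative[OF assms(4,6,7,9,10)] in \<open>simp only: p\<close>)
  moreover have "\<forall>\<^sub>F z in nhds (snd a p). f (chart_inv a z) \<in> fst b"
    using assms by (intro eventually_chart_inv) (auto simp: mdiff_at_def is_chart_def)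
  then have "\<forall>\<^sub>F z in nhds (snd a p). (?G \<circ> ?F) z = (snd c \<circ> (g \<circ> f) \<circ> chart_inv a) z"
    by eventually_elim (simp add: chart_inv_coord assms)
  ultimately show ?thesis
    by (rule has_derivative_cong_nhds)
qed

lemma mdiff_at_comp:
  assumes A: "smooth_manifold A n" and B: "smooth_manifold B m"
    and f: "mdiff_at A B f p" and g: "mdiff_at B C g (f p)"
  shows "mdiff_at A C (\<lambda>x. g (f x)) p"
  unfolding mdiff_at_def
proof (intro conjI ballI impI)
  show "isCont (\<lambda>x. g (f x)) p"
    using f g by (auto simp: mdiff_at_def intro: isCont_o2)
  fix a c assume *: "a \<in> A" "c \<in> C" "p \<in> fst a" "g (f p) \<in> fst c"
  note b = chart_at[OF B, of "f p"]
  show "(snd c \<circ> (\<lambda>x. g (f x)) \<circ> chart_inv a) differentiable at (snd a p)"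
    using has_derivative_chart_comp[OF smooth_manifold_chart[OF A *(1)]
        smooth_manifold_chart[OF B b(1)] f g *(1) b(1) *(2,3) b(2) *(4)]
    unfolding comp_def[of g f] by (rule differentiableI)
qed

text \<open>The outer \<open>tangent_map\<close> reads its argument at
  \<open>chart_at B (f p)\<close>, so this chart is the intermediate one in the chain rule; at
  charts not around the image both sides are the default \<open>0\<close>. Since \<open>v\<close> is
  read only at \<open>chart_at A p\<close>, it may be any family of coordinates.\<close>

lemma tangent_map_comp:
  assumes A: "smooth_manifold A n" and B: "smooth_manifold B m"
    and f: "mdiff_at A B f p" and g: "mdiff_at B C g (f p)"
  shows "tangent_map B C g (f p) (tangent_map A B f p v) = tangent_map A C (g \<circ> f) p v"
proof
  fix c
  let ?a = "chart_at A p" and ?b = "chart_at B (f p)"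
  show "tangent_map B C g (f p) (tangent_map A B f p v) c = tangent_map A C (g \<circ> f) p v c"
  proof (cases "c \<in> C \<and> g (f p) \<in> fst c")
    case True
    have "is_chart ?a" "is_chart ?b"
      using chart_at(1) smooth_manifold_chart A B by blast+
    from frechet_derivative_at[OF has_derivative_chart_comp[OF this f g, of c]]
    show ?thesis
      using True chart_at[OF A] chart_at[OF B] by (simp add: tangent_map_def fun_eq_iff)
  qed (auto simp: tangent_map_def)
qed

lemma tangent_map_diff:
  assumes A: "smooth_manifold A n" and f: "mdiff_at A B f p"
  shows "tangent_map A B f p (u - v) = tangent_map A B f p u - tangent_map A B f p v"
proof
  fix d
  show "tangent_map A B f p (u - v) d = (tangent_map A B f p u - tangent_map A B f p v) d"
  proof (cases "d \<in> B \<and> f p \<in> fst d")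
    case True
    then have "linear (frechet_derivative (snd d \<circ> f \<circ> chart_inv (chart_at A p))
        (at (snd (chart_at A p) p)))"
      using f chart_at[OF A] by (intro linear_frechet_derivative) (simp add: mdiff_at_def)
    then show ?thesis
      using True by (simp add: tangent_map_def linear_diff)
  qed (auto simp: tangent_map_def)
qed

section \<open>Constant maps and the identity\<close>

lemma tangent_map_const: "tangent_map A B (\<lambda>_. y) p v = 0"
  by (auto simp: tangent_map_def o_def fun_eq_iff)

lemma mdiff_at_const: "mdiff_at A B (\<lambda>_. y) p"
  by (simp add: mdiff_at_def o_def)

text \<open>In charts the identity is a transition map, so smooth compatibility of the atlas is what
  makes it differentiable.\<close>

lemma mdiff_at_id:
  assumes "smooth_manifold A n"
  shows "mdiff_at A A (\<lambda>x. x) p"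
  unfolding mdiff_at_def
proof (intro conjI ballI impI)
  fix c d assume *: "c \<in> A" "d \<in> A" "p \<in> fst c" "p \<in> fst d"
  then have "smooth_on (snd c ` (fst c \<inter> fst d)) (snd d \<circ> chart_inv c)"
    using assms unfolding smooth_manifold_def smooth_compatible_def by blast
  then have "Ck_on (Suc 0) (snd c ` (fst c \<inter> fst d)) (snd d \<circ> chart_inv c)"
    unfolding smooth_on_def by blast
  then show "(snd d \<circ> (\<lambda>x. x) \<circ> chart_inv c) differentiable at (snd c p)"
    using * by (auto simp: o_def)
qed simp


subsection \<open>Products\<close>

abbreviation prod_chart :: "('m, 'e) chart \<Rightarrow> ('n, 'f) chart \<Rightarrow> ('m \<times> 'n, 'e \<times> 'f) chart"
  where "prod_chart c d \<equiv> (fst c \<times> fst d, map_prod (snd c) (snd d))"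

lemma prod_atlasI: "c \<in> A \<Longrightarrow> d \<in> B \<Longrightarrow> prod_chart c d \<in> prod_atlas A B"
  unfolding prod_atlas_def by blast

lemma prod_atlasE:
  assumes "e \<in> prod_atlas A B"
  obtains c d where "e = prod_chart c d" "c \<in> A" "d \<in> B"
  using assms unfolding prod_atlas_def by blast

lemma mdiff_at_Pair:
  assumes f: "mdiff_at A B f p" and g: "mdiff_at A C g p"
  shows "mdiff_at A (prod_atlas B C) (\<lambda>x. (f x, g x)) p"
  unfolding mdiff_at_def
proof (intro conjI ballI impI)
  show "isCont (\<lambda>x. (f x, g x)) p"
    using f g by (intro isCont_Pair) (auto simp: mdiff_at_def)
  fix a e assume a: "a \<in> A" "p \<in> fst a" and e: "e \<in> prod_atlas B C" "(f p, g p) \<in> fst e"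
  obtain c d where cd: "e = prod_chart c d" "c \<in> B" "d \<in> C"
    using e(1) by (rule prod_atlasE)
  have p: "f p \<in> fst c" "g p \<in> fst d"
    using e(2) cd(1) by auto
  have "(\<lambda>z. ((snd c \<circ> f \<circ> chart_inv a) z, (snd d \<circ> g \<circ> chart_inv a) z)) differentiable at (snd a p)"
    by (rule differentiableI[OF has_derivative_Pair[OF
          mdiff_at_has_derivative[OF f a(1) cd(2) a(2) p(1)]
          mdiff_at_has_derivative[OF g a(1) cd(3) a(2) p(2)]]])
  then show "(snd e \<circ> (\<lambda>x. (f x, g x)) \<circ> chart_inv a) differentiable at (snd a p)"
    by (simp add: cd(1) o_def)
qed

text \<open>The inverse of a product chart factors on the image of the chart; that image is open, so
  the factorization may be used under a derivative.\<close>

lemma chart_inv_prod_nhds: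
  assumes "is_chart c" "is_chart d" "p \<in> fst c" "q \<in> fst d"
  shows "\<forall>\<^sub>F z in nhds (snd c p, snd d q).
    chart_inv (prod_chart c d) z = (chart_inv c (fst z), chart_inv d (snd z))"
proof -
  have "open ((snd c ` fst c) \<times> (snd d ` fst d))"
    using assms by (intro open_Times) (auto simp: is_chart_def)
  then have "\<forall>\<^sub>F z in nhds (snd c p, snd d q). z \<in> (snd c ` fst c) \<times> (snd d ` fst d)"
    using assms by (intro eventually_nhds_in_open) auto
  then show ?thesis
  proof eventually_elim
    case (elim z)
    from chart_inv_prod[OF this assms(1,2)] show ?case
      by (simp add: prod_eq_iff)
  qed
qed

text \<open>In a product chart the projection becomes a linear projection followed by a transition
  map of the first factor.\<close>

lemma mdiff_at_fst:
  assumes A: "smooth_manifold A n" and B: "smooth_manifold B m"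
  shows "mdiff_at (prod_atlas A B) A fst p"
  unfolding mdiff_at_def
proof (intro conjI ballI impI)
  fix e a assume e: "e \<in> prod_atlas A B" "p \<in> fst e" and a: "a \<in> A" "fst p \<in> fst a"
  obtain c d where cd: "e = prod_chart c d" "c \<in> A" "d \<in> B"
    using e(1) by (rule prod_atlasE)
  have p: "fst p \<in> fst c" "snd p \<in> fst d" "snd e p = (snd c (fst p), snd d (snd p))"
    using e(2) cd(1) by (auto simp: map_prod_def split: prod.splits)
  obtain F where "(snd a \<circ> chart_inv c has_derivative F) (at (snd c (fst p)))"
    using mdiff_at_has_derivative[OF mdiff_at_id[OF A] cd(2) a(1) p(1) a(2)] by (auto simp: o_def)
  then have "((\<lambda>z. (snd a \<circ> chart_inv c) (fst z)) has_derivative (\<lambda>h. F (fst h))) (at (snd e p))"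
    by (intro has_derivative_compose[OF has_derivative_fst[OF has_derivative_ident]]) (simp only: p(3) fst_conv)
  moreover have "\<forall>\<^sub>F z in nhds (snd e p). (snd a \<circ> chart_inv c) (fst z) = (snd a \<circ> fst \<circ> chart_inv e) z"
    using chart_inv_prod_nhds[OF _ _ p(1,2)] smooth_manifold_chart[OF A cd(2)]
      smooth_manifold_chart[OF B cd(3)] unfolding p(3) unfolding cd(1)
    by (auto elim!: eventually_mono)
  ultimately show "(snd a \<circ> fst \<circ> chart_inv e) differentiable at (snd e p)"
    by (intro differentiableI[OF has_derivative_cong_nhds])
qed simp

lemma mdiff_at_snd:
  assumes A: "smooth_manifold A n" and B: "smooth_manifold B m"
  shows "mdiff_at (prod_atlas A B) B snd p"
  unfolding mdiff_at_def
proof (intro conjI ballI impI)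
  fix e b assume e: "e \<in> prod_atlas A B" "p \<in> fst e" and b: "b \<in> B" "snd p \<in> fst b"
  obtain c d where cd: "e = prod_chart c d" "c \<in> A" "d \<in> B"
    using e(1) by (rule prod_atlasE)
  have p: "fst p \<in> fst c" "snd p \<in> fst d" "snd e p = (snd c (fst p), snd d (snd p))"
    using e(2) cd(1) by (auto simp: map_prod_def split: prod.splits)
  obtain F where "(snd b \<circ> chart_inv d has_derivative F) (at (snd d (snd p)))"
    using mdiff_at_has_derivative[OF mdiff_at_id[OF B] cd(3) b(1) p(2) b(2)] by (auto simp: o_def)
  then have "((\<lambda>z. (snd b \<circ> chart_inv d) (snd z)) has_derivative (\<lambda>h. F (snd h))) (at (snd e p))"
    by (intro has_derivative_compose[OF has_derivative_snd[OF has_derivative_ident]]) (simp only: p(3) snd_conv)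
  moreover have "\<forall>\<^sub>F z in nhds (snd e p). (snd b \<circ> chart_inv d) (snd z) = (snd b \<circ> snd \<circ> chart_inv e) z"
    using chart_inv_prod_nhds[OF _ _ p(1,2)] smooth_manifold_chart[OF A cd(2)]
      smooth_manifold_chart[OF B cd(3)] unfolding p(3) unfolding cd(1)
    by (auto elim!: eventually_mono)
  ultimately show "(snd b \<circ> snd \<circ> chart_inv e) differentiable at (snd e p)"
    by (intro differentiableI[OF has_derivative_cong_nhds])
qed simp

section \<open>Partial derivatives of a map on a product\<close>

lemma has_derivative_chart_Pair:
  assumes "is_chart a" "is_chart b" "is_chart c"
    and "mdiff_at A B f p" "mdiff_at A C g p" "mdiff_at (prod_atlas B C) E F (f p, g p)"
    and "a \<in> A" "b \<in> B" "c \<in> C" "e \<in> E"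
    and "p \<in> fst a" "f p \<in> fst b" "g p \<in> fst c" "F (f p, g p) \<in> fst e"
  shows "(snd e \<circ> (\<lambda>x. F (f x, g x)) \<circ> chart_inv a has_derivative
    (\<lambda>h. frechet_derivative (snd e \<circ> F \<circ> chart_inv (prod_chart b c)) (at (snd b (f p), snd c (g p)))
      (frechet_derivative (snd b \<circ> f \<circ> chart_inv a) (at (snd a p)) h,
       frechet_derivative (snd c \<circ> g \<circ> chart_inv a) (at (snd a p)) h))) (at (snd a p))"
proof -
  let ?f = "snd b \<circ> f \<circ> chart_inv a" and ?g = "snd c \<circ> g \<circ> chart_inv a"
  have eq: "snd (prod_chart b c) \<circ> (\<lambda>x. (f x, g x)) \<circ> chart_inv a = (\<lambda>z. (?f z, ?g z))"
    by (simp add: fun_eq_iff)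
  have d: "frechet_derivative (\<lambda>z. (?f z, ?g z)) (at (snd a p)) =
      (\<lambda>h. (frechet_derivative ?f (at (snd a p)) h, frechet_derivative ?g (at (snd a p)) h))"
    by (rule frechet_derivative_at[symmetric], rule has_derivative_Pair[OF
          mdiff_at_has_derivative[OF assms(4,7,8,11,12)]
          mdiff_at_has_derivative[OF assms(5,7,9,11,13)]])
  show ?thesis
    \<comment> \<open>The chain rule passes through the product of \<open>b\<close> and
      \<open>c\<close> as the intermediate chart.\<close>
    using has_derivative_chart_comp[OF assms(1) is_chart_prod[OF assms(2,3)]
        mdiff_at_Pair[OF assms(4,5)] assms(6,7) prod_atlasI[OF assms(8,9)] assms(10,11)]
      assms(12-14)
    unfolding eq d by (simp add: o_def)
qed

text \<open>The derivative of \<open>F\<close> is linear, so its value at \<open>(x, y)\<close> is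
  the sum of its values at \<open>(x, 0)\<close> and \<open>(0, y)\<close>. Freezing
  \<open>g\<close> or \<open>f\<close> at \<open>p\<close> replaces the corresponding component by
  zero.\<close>

lemma tangent_map_partials:
  assumes A: "smooth_manifold A n" and B: "smooth_manifold B m" and C: "smooth_manifold C k"
    and f: "mdiff_at A B f p" and g: "mdiff_at A C g p"
    and F: "mdiff_at (prod_atlas B C) E F (f p, g p)"
  shows "tangent_map A E (\<lambda>x. F (f x, g x)) p v =
    tangent_map A E (\<lambda>x. F (f x, g p)) p v + tangent_map A E (\<lambda>x. F (f p, g x)) p v"
proof
  fix e
  let ?a = "chart_at A p" and ?b = "chart_at B (f p)" and ?c = "chart_at C (g p)"
  show "tangent_map A E (\<lambda>x. F (f x, g x)) p v e =
    (tangent_map A E (\<lambda>x. F (f x, g p)) p v + tangent_map A E (\<lambda>x. F (f p, g x)) p v) e"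
  proof (cases "e \<in> E \<and> F (f p, g p) \<in> fst e")
    case True
    have "is_chart ?a" "is_chart ?b" "is_chart ?c"
      using chart_at(1) smooth_manifold_chart A B C by blast+
    note at = chart_at[OF A] chart_at[OF B] chart_at[OF C]
    let ?F = "frechet_derivative (snd e \<circ> F \<circ> chart_inv (prod_chart ?b ?c))
      (at (snd ?b (f p), snd ?c (g p)))"
    have F_linear: "linear ?F"
      using mdiff_at_has_derivative[OF F prod_atlasI, of ?b ?c e] at True
      by (auto intro: has_derivative_linear)
    then have lin: "?F (x, y) = ?F (x, 0) + ?F (0, y)" for x y
      using linear_add[OF F_linear, of "(x, 0)" "(0, y)"] by simp
    have z: "frechet_derivative (snd ?b \<circ> (\<lambda>_. f p) \<circ> chart_inv ?a) (at (snd ?a p)) = (\<lambda>_. 0)"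
      "frechet_derivative (snd ?c \<circ> (\<lambda>_. g p) \<circ> chart_inv ?a) (at (snd ?a p)) = (\<lambda>_. 0)"
      by (simp_all add: o_def)
    have e: "e \<in> E" "F (f p, g p) \<in> fst e"
      using True by auto
    \<comment> \<open>Stated for variable \<open>f'\<close> and \<open>g'\<close> to serve the full
      map and both frozen ones: they agree at \<open>p\<close>, so all three share the outer
      derivative \<open>?F\<close>.\<close>
    have D: "frechet_derivative (snd e \<circ> (\<lambda>x. F (f' x, g' x)) \<circ> chart_inv ?a) (at (snd ?a p)) =
        (\<lambda>h. ?F (frechet_derivative (snd ?b \<circ> f' \<circ> chart_inv ?a) (at (snd ?a p)) h,
          frechet_derivative (snd ?c \<circ> g' \<circ> chart_inv ?a) (at (snd ?a p)) h))"
      if "mdiff_at A B f' p" "mdiff_at A C g' p" "f' p = f p" "g' p = g p" for f' g'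
      using has_derivative_chart_Pair[OF \<open>is_chart ?a\<close> \<open>is_chart ?b\<close> \<open>is_chart ?c\<close> that(1,2)
          F[folded that(3,4)] at(1) at(3) at(5) e(1) at(2) _ _ e(2)[folded that(3,4)]] at(4,6) that(3,4)
      by (intro frechet_derivative_at[symmetric]) simp
    show ?thesis
      unfolding tangent_map_def plus_fun_apply
      using e
      by (simp only: D[OF f g refl refl] D[OF f mdiff_at_const refl refl]
          D[OF mdiff_at_const g refl refl] z if_True simp_thms)
        (rule lin)
  qed (auto simp: tangent_map_def)
qed

subsection \<open>The discrete Lagrangian one-forms on infinitesimal generators\<close>

lemma chart_at_vec_atlas: "chart_at vec_atlas p = id_chart"
  unfolding chart_at_def by (rule some_equality) (auto simp: vec_atlas_def id_chart_def)

text \<open>A tangent vector of the real line is the number at \<open>id_chart\<close>, on which the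
  differential acts by multiplication. This matches the time terms, defined by \<open>deriv\<close>,
  with tangent maps.\<close>

lemma deriv_eq_differential:
  fixes f :: "real \<Rightarrow> real"
  assumes "mdiff_at vec_atlas vec_atlas f t"
  shows "deriv f t * v id_chart = differential vec_atlas f t v"
proof -
  have d: "f differentiable at t"
    using assms unfolding mdiff_at_def vec_atlas_def
    by (simp add: chart_inv_id_chart) (simp add: id_chart_def)
  then have "(f has_derivative (*) (deriv f t)) (at t)"
    using DERIV_deriv_iff_real_differentiable by (auto simp: has_field_derivative_def)
  from frechet_derivative_at[OF this]
  show ?thesis
    unfolding differential_def tangent_map_def chart_at_vec_atlas
    by (simp add: vec_atlas_def chart_inv_id_chart) (simp add: id_chart_def fun_eq_iff)
qed

text \<open>The left side has the shape of the discrete one-forms: partial differentials of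
  \<open>f\<close> paired with the \<open>dq\<close> and \<open>dt\<close> components of a
  pushed-forward vector. The chain rule turns it into a differential on the source of
  \<open>u\<close>, later the group.\<close>

lemma differential_ext_split:
  assumes A: "smooth_manifold A n" and G: "smooth_manifold AG m"
    and f: "mdiff_at (ext_atlas A) vec_atlas f (u g)" and u: "mdiff_at AG (ext_atlas A) u g"
  shows "differential A (\<lambda>q. f (fst (u g), q)) (snd (u g)) (dq A (u g) (tangent_map AG (ext_atlas A) u g v)) +
      deriv (\<lambda>t. f (t, snd (u g))) (fst (u g)) * dt A (u g) (tangent_map AG (ext_atlas A) u g v) =
    differential AG (\<lambda>x. f (u x)) g v"
proof -
  note R = smooth_manifold_real and X = smooth_manifold_ext[OF A]
  let ?u = "fst (u g)" and ?w = "snd (u g)"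
  have fst: "mdiff_at (ext_atlas A) vec_atlas fst x" and snd: "mdiff_at (ext_atlas A) A snd x" for x
    unfolding ext_atlas_def using mdiff_at_fst[OF R A] mdiff_at_snd[OF R A] by auto
  \<comment> \<open>Each slice is \<open>f\<close> after an inclusion of one factor, with the other
    coordinate held constant.\<close>
  have f1: "mdiff_at vec_atlas vec_atlas (\<lambda>t. f (t, ?w)) ?u"
    using mdiff_at_comp[OF R X mdiff_at_Pair[OF mdiff_at_id[OF R] mdiff_at_const[of _ A], folded ext_atlas_def],
        of vec_atlas f ?u ?w] f by simp
  have f2: "mdiff_at A vec_atlas (\<lambda>q. f (?u, q)) ?w"
    using mdiff_at_comp[OF A X mdiff_at_Pair[OF mdiff_at_const[of _ "vec_atlas :: (real, real) atlas"] mdiff_at_id[OF A], folded ext_atlas_def],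
        of vec_atlas f ?u ?w] f by simp
  have u1: "mdiff_at AG vec_atlas (\<lambda>x. fst (u x)) g" and u2: "mdiff_at AG A (\<lambda>x. snd (u x)) g"
    by (rule mdiff_at_comp[OF G X u fst] mdiff_at_comp[OF G X u snd])+
  have "tangent_map AG vec_atlas (\<lambda>x. f (fst (u x), snd (u x))) g v =
      tangent_map AG vec_atlas (\<lambda>x. f (fst (u x), snd (u g))) g v +
      tangent_map AG vec_atlas (\<lambda>x. f (fst (u g), snd (u x))) g v"
    using f by (intro tangent_map_partials[OF G R A u1 u2]) (simp add: ext_atlas_def)
  \<comment> \<open>Two chain rules: first \<open>fst\<close> after \<open>u\<close>, then the time
    slice after that composite. The position term below is treated alike.\<close>
  moreover have "tangent_map vec_atlas vec_atlas (\<lambda>t. f (t, ?w)) ?u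
      (tangent_map (ext_atlas A) vec_atlas fst (u g) (tangent_map AG (ext_atlas A) u g v)) =
      tangent_map AG vec_atlas (\<lambda>x. f (fst (u x), snd (u g))) g v"
    using tangent_map_comp[OF G X u fst, of v] tangent_map_comp[OF G R u1, of vec_atlas _ v] f1
    by (simp add: o_def)
  moreover have "tangent_map A vec_atlas (\<lambda>q. f (?u, q)) ?w
      (tangent_map (ext_atlas A) A snd (u g) (tangent_map AG (ext_atlas A) u g v)) =
      tangent_map AG vec_atlas (\<lambda>x. f (fst (u g), snd (u x))) g v"
    using tangent_map_comp[OF G X u snd, of v] tangent_map_comp[OF G A u2, of vec_atlas _ v] f2
    by (simp add: o_def)
  ultimately show ?thesis
    unfolding dt_def dq_def differential_def[of "ext_atlas A"] deriv_eq_differential[OF f1]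
    by (simp add: differential_def)
qed

section \<open>Orbit maps and the one-forms on generators\<close>

lemma action_orbit_mdiff_at:
  assumes A: "smooth_manifold A n" and G: "smooth_manifold AG m"
    and act: "lie_group_action AG mul one A act"
  shows "mdiff_at AG A (\<lambda>g. act g x) g"
proof -
  have "mdiff_at (prod_atlas AG A) A (\<lambda>(g, x). act g x) (g, x)"
    using act smooth_manifold_prod[OF G A] A
    by (intro smooth_map_mdiff_at) (auto simp: lie_group_action_def)
  \<comment> \<open>The orbit map is the inclusion of the group at fixed \<open>x\<close> followed
    by the action.\<close>
  from mdiff_at_comp[OF G smooth_manifold_prod[OF G A]
      mdiff_at_Pair[OF mdiff_at_id[OF G] mdiff_at_const] this]
  show ?thesis by (simp add: o_def)
qed

locale smooth_lagrangian_action =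
  fixes A :: "('q::{t2_space, second_countable_topology}, 'e::real_normed_vector) atlas"
    and AG :: "('g::{t2_space, second_countable_topology}, 'h::real_normed_vector) atlas"
    and n m mul one act and L :: "(real \<times> 'q) \<times> (real \<times> 'q) \<Rightarrow> real"
  assumes Q: "smooth_manifold A n" and G: "smooth_manifold AG m"
    and action: "lie_group_action AG mul one (ext_atlas A) act"
    and L: "smooth_map (prod_atlas (ext_atlas A) (ext_atlas A)) vec_atlas L"
begin

lemmas X = smooth_manifold_ext[OF Q]

lemma act_one: "act one x = x"
  using action unfolding lie_group_action_def by blast

lemma L_mdiff_at: "mdiff_at (prod_atlas (ext_atlas A) (ext_atlas A)) vec_atlas L p"
  using smooth_map_mdiff_at[OF smooth_manifold_prod[OF X X] smooth_manifold_real L] .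

lemma L_fst_mdiff_at: "mdiff_at (ext_atlas A) vec_atlas (\<lambda>x. L (x, y)) p"
  using mdiff_at_comp[OF X smooth_manifold_prod[OF X X]
      mdiff_at_Pair[OF mdiff_at_id[OF X] mdiff_at_const] L_mdiff_at]
  by (simp add: o_def)

lemma L_snd_mdiff_at: "mdiff_at (ext_atlas A) vec_atlas (\<lambda>y. L (x, y)) p"
  using mdiff_at_comp[OF X smooth_manifold_prod[OF X X]
      mdiff_at_Pair[OF mdiff_at_const mdiff_at_id[OF X]] L_mdiff_at]
  by (simp add: o_def)

lemmas orbit_mdiff_at = action_orbit_mdiff_at[OF X G action]

text \<open>This is \<open>differential_ext_split\<close> for \<open>L\<close> with first point
  \<open>x\<close>, along the orbit map of \<open>y\<close>; \<open>act_one\<close> identifies the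
  base point \<open>act one y\<close> with \<open>y\<close>. The vector \<open>w\<close> is free
  because \<open>Theta_plus\<close> reads only the second component.\<close>

lemma Theta_plus_generator:
  "Theta_plus A L (x, y) (w, inf_generator AG one (ext_atlas A) act \<xi> y) =
    differential AG (\<lambda>g. L (x, act g y)) one \<xi>"
  using differential_ext_split[where u="\<lambda>g. act g y" and g=one and v=\<xi>,
      OF Q G L_snd_mdiff_at orbit_mdiff_at, of x]
  by (cases x; cases y) (simp add: Theta_plus_def inf_generator_def act_one)

lemma Theta_minus_generator:
  "Theta_minus A L (x, y) (inf_generator AG one (ext_atlas A) act \<xi> x, w) =
    - differential AG (\<lambda>g. L (act g x, y)) one \<xi>"
  using differential_ext_split[where u="\<lambda>g. act g x" and g=one and v=\<xi>,
      OF Q G L_fst_mdiff_at orbit_mdiff_at, of y]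
  by (cases x; cases y) (simp add: Theta_minus_def inf_generator_def act_one)

text \<open>By \<open>Theta_plus_generator\<close> all three pairings are the tangent map of one
  function on the group, so its linearity handles the generator and the one-form together.\<close>

lemma Theta_plus_generator_diff:
  "Theta_plus A L (x, y) (w, inf_generator AG one (ext_atlas A) act (\<xi> - \<eta>) y) =
    Theta_plus A L (x, y) (w', inf_generator AG one (ext_atlas A) act \<xi> y) -
    Theta_plus A L (x, y) (w'', inf_generator AG one (ext_atlas A) act \<eta> y)"
proof -
  have "mdiff_at AG vec_atlas (\<lambda>g. L (x, act g y)) one"
    using mdiff_at_comp[OF G X orbit_mdiff_at L_snd_mdiff_at] by (simp add: o_def)
  then show ?thesis
    unfolding Theta_plus_generator differential_def by (simp add: tangent_map_diff[OF G])
qed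

text \<open>Along the diagonal orbit \<open>L\<close> is constant, so its two partial derivatives
  cancel; they are \<open>Theta_plus\<close> and minus \<open>Theta_minus\<close> on the
  generators.\<close>

lemma Theta_plus_eq_Theta_minus:
  assumes "\<And>g p. L (map_prod (act g) (act g) p) = L p"
  shows "Theta_plus A L (x, y) (w, inf_generator AG one (ext_atlas A) act \<xi> y) =
    Theta_minus A L (x, y) (inf_generator AG one (ext_atlas A) act \<xi> x, w')"
proof -
  have "L (act g x, act g y) = L (x, y)" for g
    using assms[of g "(x, y)"] by simp
  moreover have "tangent_map AG vec_atlas (\<lambda>g. L (act g x, act g y)) one \<xi> =
      tangent_map AG vec_atlas (\<lambda>g. L (act g x, y)) one \<xi> +
      tangent_map AG vec_atlas (\<lambda>g. L (x, act g y)) one \<xi>"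
    using tangent_map_partials[where f="\<lambda>g. act g x" and g="\<lambda>g. act g y" and p=one and v=\<xi>,
        OF G X X orbit_mdiff_at orbit_mdiff_at L_mdiff_at]
    by (simp add: act_one)
  ultimately have "tangent_map AG vec_atlas (\<lambda>g. L (act g x, y)) one \<xi> +
      tangent_map AG vec_atlas (\<lambda>g. L (x, act g y)) one \<xi> = 0"
    by (simp add: tangent_map_const)
  \<comment> \<open>Reading the vanishing tangent vector at \<open>id_chart\<close> gives the
    equation between real numbers.\<close>
  from fun_cong[OF this, of id_chart] show ?thesis
    unfolding Theta_plus_generator Theta_minus_generator differential_def by simp
qed

end

text \<open>The Euler-Lagrange covector is the mismatch of the two one-forms at the shared middle
  point; the minus signs in \<open>Theta_minus\<close> turn its sums into a difference.\<close>

lemma D_DEL_eq_Theta: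
  "D_DEL A L x0 x1 x2 v = Theta_plus A L (x0, x1) (w, v) - Theta_minus A L (x1, x2) (v, w')"
  by (simp add: D_DEL_def Theta_plus_def Theta_minus_def algebra_simps)

theorem proposition1:
  fixes A :: "('q::{t2_space, second_countable_topology}, 'e::real_normed_vector) atlas"
    and n :: nat
    and L :: "(real \<times> 'q) \<times> (real \<times> 'q) \<Rightarrow> real"
    and Dd :: "((real \<times> 'q) \<times> (real \<times> 'q)) set"
    and D :: "real \<times> 'q \<Rightarrow> (real \<times> 'q, real \<times> 'e) tangent set"
    and AG :: "('g::{t2_space, second_countable_topology}, 'h::real_normed_vector) atlas"
    and mul :: "'g \<Rightarrow> 'g \<Rightarrow> 'g" and one :: 'g and ginv :: "'g \<Rightarrow> 'g"
    and act :: "'g \<Rightarrow> real \<times> 'q \<Rightarrow> real \<times> 'q"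
    and \<sigma> :: "real \<times> 'q \<Rightarrow> ('g, 'h) tangent"
  assumes "ext_discrete_nh_system A n L Dd D"
    and "EDLA_well_posed A L Dd D"
    and "lie_group AG mul one ginv"
    and "lie_group_action AG mul one (ext_atlas A) act"
    and "G_invariant_system A act L Dd D"
    and "smooth_gD_section AG one A act D \<sigma>"
  shows "\<forall>t0 q0 t1 q1 t2 q2.
    EDLA_map A L Dd D ((t0, q0), (t1, q1)) = ((t1, q1), (t2, q2)) \<longrightarrow>
    nh_momentum_map AG one A act L ((t1, q1), (t2, q2)) \<sigma>
      - nh_momentum_map AG one A act L ((t0, q0), (t1, q1)) \<sigma>
    = Theta_plus_snd A L ((t1, q1), (t2, q2))
        (inf_generator AG one (ext_atlas A) act (\<sigma> (t2, q2) - \<sigma> (t1, q1)) (t2, q2))"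
proof (intro allI impI)
  fix t0 t1 t2 :: real and q0 q1 q2 :: 'q
  define x0 where "x0 = (t0, q0)"
  define x1 where "x1 = (t1, q1)"
  define x2 where "x2 = (t2, q2)"
  assume "EDLA_map A L Dd D ((t0, q0), (t1, q1)) = ((t1, q1), (t2, q2))"
  then have "(THE x2. EDLA_equations A L Dd D x0 x1 x2) = x2"
    by (simp add: EDLA_map_def x0_def x1_def x2_def)
  \<comment> \<open>\<open>EDLA_map\<close> is a definite description; well-posedness makes the
    point it denotes a solution.\<close>
  then have "EDLA_equations A L Dd D x0 x1 x2"
    using theI'[of "EDLA_equations A L Dd D x0 x1"] assms(2) unfolding EDLA_well_posed_def by metis
  then have annih: "D_DEL A L x0 x1 x2 v = 0" if "v \<in> D x1" for v
    using that by (simp add: EDLA_equations_def annihilator_def)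
  obtain m where "smooth_manifold AG m"
    using assms(3) unfolding lie_group_def by blast
  then interpret smooth_lagrangian_action A AG n m mul one act L
    using assms(1,4) by unfold_locales (auto simp: ext_discrete_nh_system_def)
  let ?gen = "inf_generator AG one (ext_atlas A) act"
  \<comment> \<open>The equations test covectors against \<open>D\<close> at \<open>x1\<close>, so
    the value of the section there is an admissible direction; it is kept fixed when passing to
    \<open>x2\<close>.\<close>
  have "?gen (\<sigma> x1) x1 \<in> D x1"
    using assms(6) unfolding smooth_gD_section_def gD_fiber_def by blast
  then have EDLA: "Theta_plus A L (x0, x1) (w, ?gen (\<sigma> x1) x1) = Theta_minus A L (x1, x2) (?gen (\<sigma> x1) x1, w')"
    for w w'
    using annih D_DEL_eq_Theta[of A L x0 x1 x2 "?gen (\<sigma> x1) x1" w w'] by simp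
  have "Theta_minus A L (x1, x2) (?gen (\<sigma> x1) x1, w') = Theta_plus A L (x1, x2) (w, ?gen (\<sigma> x1) x2)"
    for w w'
    by (rule Theta_plus_eq_Theta_minus[symmetric])
      (use assms(5) in \<open>unfold G_invariant_system_def, blast\<close>)
  then have "Theta_plus A L (x0, x1) (w, ?gen (\<sigma> x1) x1) = Theta_plus A L (x1, x2) (w', ?gen (\<sigma> x1) x2)"
    for w w'
    using EDLA by metis
  then show "nh_momentum_map AG one A act L ((t1, q1), (t2, q2)) \<sigma>
      - nh_momentum_map AG one A act L ((t0, q0), (t1, q1)) \<sigma>
    = Theta_plus_snd A L ((t1, q1), (t2, q2)) (?gen (\<sigma> (t2, q2) - \<sigma> (t1, q1)) (t2, q2))"
    unfolding x0_def[symmetric] x1_def[symmetric] x2_def[symmetric]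
    \<comment> \<open>The momentum at \<open>(x1, x2)\<close> uses \<open>\<sigma> x2\<close>, which
      leaves the difference with \<open>\<sigma> x1\<close> on the right. The free first components
      are set to those of the diagonal generators at \<open>(x1, x2)\<close>, so that the
      \<open>\<sigma> x2\<close> terms cancel literally.\<close>
    by (simp add: nh_momentum_map_def momentum_map_def diag_generator_def Theta_plus_snd_def
        Theta_plus_generator_diff[where w'="?gen (\<sigma> x2) x1" and w''="?gen (\<sigma> x1) x1"])
qed

end
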